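(* Connectedness (the graph property consisting of all connected graphs on the vertex set $\mathbb{N}$) is $\infty$-elusive.
   Context: Let $[\mathbb{N}]^2=\{\{n,k\}: n,k\in\mathbb{N},\ n\neq k\}$. A graph on $\mathbb{N}$ is a subset $G\subseteq[\mathbb{N}]^2$, so the set of graphs is $2^{[\mathbb{N}]^2}$. A graph property is an isomorphism-invariant subset $\mathcal{S}\subseteq 2^{[\mathbb{N}]^2}$. The game $G(\mathcal{S})$. Two players, Seeker and Hider, colour the edges of the complete graph on $\mathbb{N}$ with red, white, green. Initially all edges are white. In each turn Seeker picks a white edge and Hider recolours it green or red. The game terminates after infinitely many (that is, $\omega$ many) turns. Let $R_\infty,W_\infty,G_\infty$ be the sets of red, white and green edges at the end, and let $\mathcal{P}_\infty=\{G\subseteq[\mathbb{N}]^2: G_\infty\subseteq G\subseteq G_\infty\cup W_\infty\}$. Seeker wins if and only if $W_\infty\neq\emptyset$ and either $\mathcal{P}_\infty\subseteq\mathcal{S}$ or $\mathcal{P}_\infty\subseteq 2^{[\mathbb{N}]^2}\setminus\mathcal{S}$; otherwise Hider wins. The property $\mathcal{S}$ is $\infty$-elusive if Seeker does not have a winning strategy in $G(\mathcal{S})$. *)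

theory Defs
  imports Main
begin

type_synonym edge = "nat set"
type_synonym graph = "edge set"

definition all_edges :: "edge set" where
  "all_edges = {{n, k} | n k. n \<noteq> k}"

definition graphs :: "graph set" where
  "graphs = Pow all_edges"

text \<open>Every isomorphism between graphs on \<open>\<nat>\<close> is the renaming of vertices by a permutation \<open>f\<close>
  of \<open>\<nat>\<close>. As \<open>f\<close> ranges over all permutations, hence also over inverses, closure under renaming
  is the same as invariance.\<close>

definition graph_property :: "graph set \<Rightarrow> bool" where
  "graph_property S \<longleftrightarrow> S \<subseteq> graphs \<and> (\<forall>f :: nat \<Rightarrow> nat. bij f \<longrightarrow> (\<forall>G \<in> S. (\<lambda>e. f ` e) ` G \<in> S))"

definition adjacency :: "graph \<Rightarrow> (nat \<times> nat) set" where
  "adjacency G = {(u, v). {u, v} \<in> G}"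

definition connectedness :: "graph set" where
  "connectedness = {G \<in> graphs. \<forall>u v. (u, v) \<in> (adjacency G)\<^sup>*}"

text \<open>White is the absence of a colour: an edge is white as long as it has not been picked.
  A turn consists of the edge picked by Seeker and the colour Hider gives to it.\<close>

datatype colour = Red | Green

type_synonym turn = "edge \<times> colour"

definition white_edges :: "turn set \<Rightarrow> edge set" where
  "white_edges T = all_edges - fst ` T"

definition green_edges :: "turn set \<Rightarrow> edge set" where
  "green_edges T = {e. (e, Green) \<in> T}"

definition legal_history :: "turn list \<Rightarrow> bool" where
  "legal_history h \<longleftrightarrow> (\<forall>i < length h. fst (h ! i) \<in> white_edges (set (take i h)))"

definition legal_play :: "(nat \<Rightarrow> turn) \<Rightarrow> bool" where
  "legal_play p \<longleftrightarrow> (\<forall>n. fst (p n) \<in> white_edges (p ` {..<n}))"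

definition possible_graphs :: "(nat \<Rightarrow> turn) \<Rightarrow> graph set" where
  "possible_graphs p = {G \<in> graphs. green_edges (range p) \<subseteq> G \<and>
     G \<subseteq> green_edges (range p) \<union> white_edges (range p)}"

definition seeker_wins :: "graph set \<Rightarrow> (nat \<Rightarrow> turn) \<Rightarrow> bool" where
  "seeker_wins S p \<longleftrightarrow> white_edges (range p) \<noteq> {} \<and>
     (possible_graphs p \<subseteq> S \<or> possible_graphs p \<subseteq> graphs - S)"

text \<open>A strategy of Seeker prescribes the next edge from the full history of the game. A white edge
  exists after every finite history, so strategies exist and never get stuck.\<close>

definition seeker_strategy :: "(turn list \<Rightarrow> edge) \<Rightarrow> bool" where
  "seeker_strategy \<sigma> \<longleftrightarrow> (\<forall>h. legal_history h \<longrightarrow> \<sigma> h \<in> white_edges (set h))"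

definition follows :: "(turn list \<Rightarrow> edge) \<Rightarrow> (nat \<Rightarrow> turn) \<Rightarrow> bool" where
  "follows \<sigma> p \<longleftrightarrow> (\<forall>n. fst (p n) = \<sigma> (map p [0..<n]))"

definition winning_strategy :: "graph set \<Rightarrow> (turn list \<Rightarrow> edge) \<Rightarrow> bool" where
  "winning_strategy S \<sigma> \<longleftrightarrow> seeker_strategy \<sigma> \<and>
     (\<forall>p. legal_play p \<and> follows \<sigma> p \<longrightarrow> seeker_wins S p)"

definition infinity_elusive :: "graph set \<Rightarrow> bool" where
  "infinity_elusive S \<longleftrightarrow> \<not> (\<exists>\<sigma>. winning_strategy S \<sigma>)"

lemma graph_property_connectedness: "graph_property connectedness"
  unfolding graph_property_def
proof (intro conjI allI impI ballI)
  show "connectedness \<subseteq> graphs" by (auto simp: connectedness_def)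
  fix f :: "nat \<Rightarrow> nat" and G assume f: "bij f" and G: "G \<in> connectedness"
  let ?H = "(\<lambda>e. f ` e) ` G"
  have "f ` e \<in> all_edges" if "e \<in> G" for e
  proof -
    from that G obtain n k where "e = {n, k}" "n \<noteq> k"
      by (auto simp: connectedness_def graphs_def all_edges_def)
    moreover have "f n \<noteq> f k" using f \<open>n \<noteq> k\<close> by (meson bij_is_inj injD)
    ultimately show ?thesis unfolding all_edges_def by auto
  qed
  then have H: "?H \<in> graphs" by (auto simp: graphs_def)
  have step: "(f u, f v) \<in> adjacency ?H" if "(u, v) \<in> adjacency G" for u v
    using imageI[of "{u, v}" G "\<lambda>e. f ` e"] that by (simp add: adjacency_def)
  have path: "(f u, f v) \<in> (adjacency ?H)\<^sup>*" if "(u, v) \<in> (adjacency G)\<^sup>*" for u v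
    using that by (induction rule: rtrancl_induct) (auto intro: rtrancl_into_rtrancl step)
  have "(u, v) \<in> (adjacency ?H)\<^sup>*" for u v
  proof -
    obtain a b where "u = f a" "v = f b" using f by (meson bij_is_surj surjD)
    then show ?thesis using path[of a b] G by (simp add: connectedness_def)
  qed
  with H show "?H \<in> connectedness" by (simp add: connectedness_def)
qed

end

theory Submission imports Defs begin

text \<open>Hider treats the vertices one at a time. Each vertex \<open>n > 0\<close> has exactly \<open>n\<close> edges to smaller
  vertices. Hider answers red to all of these except the one that is picked last, and green to that
  one. These edges are finitely many, so Hider can tell the last one when it is picked, and \<open>n\<close> gets
  its green edge at some finite stage unless one of them stays white forever.

  If every edge gets picked, Hider wins because no white edge is left. Otherwise some \<open>n > 0\<close> has a
  white edge to a smaller vertex, and both outcomes remain possible. Filling the white edges with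
  green connects the graph, since then each vertex other than \<open>0\<close> has an edge to a smaller one: the
  green one if all its edges downwards were picked, and a white one if not. Filling them with red
  leaves a forest in which each vertex has at most one edge to a smaller vertex, its parent;
  both \<open>0\<close> and \<open>n\<close> have no parent, so they are roots of different trees.\<close>

section \<open>The play between two given strategies\<close>

text \<open>Both players' rules determine the next turn from the history, so the play arises by iteration.
  It is legal by induction on the turns, since a strategy of Seeker is only bound to pick a white edge
  after a legal history.\<close>

lemma play_against_reply_exists:
  fixes reply :: "turn set \<Rightarrow> edge \<Rightarrow> colour"
  assumes "seeker_strategy \<sigma>"
  obtains p where "legal_play p" "follows \<sigma> p"
    "\<forall>i. snd (p i) = reply (p ` {..<i}) (fst (p i))"
proof -
  define extend where "extend h = h @ [(\<sigma> h, reply (set h) (\<sigma> h))]" for h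
  define hist where "hist n = (extend ^^ n) []" for n
  define p where "p n = (\<sigma> (hist n), reply (set (hist n)) (\<sigma> (hist n)))" for n
  have hist: "hist n = map p [0..<n]" for n
  proof (induction n)
    case 0
    then show ?case by (simp add: hist_def)
  next
    case (Suc n)
    have "hist (Suc n) = hist n @ [p n]"
      by (simp add: hist_def p_def extend_def)
    with Suc show ?case by simp
  qed
  have set_hist: "set (hist n) = p ` {..<n}" for n
    by (simp add: hist atLeast0LessThan)
  have white: "fst (p n) \<in> white_edges (p ` {..<n})" for n
  proof (induction n rule: less_induct)
    case (less n)
    have "fst (hist n ! i) \<in> white_edges (set (take i (hist n)))" if "i < n" for i
    proof -
      have "take i (hist n) = hist i" "hist n ! i = p i"
        using that by (simp_all add: hist take_map)
      with less[OF that] show ?thesis by (simp add: set_hist)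
    qed
    moreover have "length (hist n) = n" by (simp add: hist)
    ultimately have "legal_history (hist n)" by (simp add: legal_history_def)
    then have "\<sigma> (hist n) \<in> white_edges (set (hist n))"
      using assms by (simp add: seeker_strategy_def)
    moreover have "fst (p n) = \<sigma> (hist n)" by (simp add: p_def)
    ultimately show ?case by (simp add: set_hist)
  qed
  show thesis
  proof
    show "legal_play p" using white by (simp add: legal_play_def)
    show "follows \<sigma> p" unfolding follows_def hist[symmetric] by (simp add: p_def)
    show "\<forall>i. snd (p i) = reply (p ` {..<i}) (fst (p i))"
      unfolding set_hist[symmetric] by (simp add: p_def)
  qed
qed

lemma legal_play_picks_distinct:
  assumes "legal_play p" "fst (p i) = fst (p j)"
  shows "i = j"
proof -
  have "fst (p m) \<noteq> fst (p n)" if "m < n" for m n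
  proof -
    have "fst (p n) \<notin> fst ` p ` {..<n}"
      using assms(1) by (simp add: legal_play_def white_edges_def)
    moreover have "fst (p m) \<in> fst ` p ` {..<n}"
      using that by simp
    ultimately show ?thesis by metis
  qed
  with assms(2) show ?thesis by (metis linorder_neqE_nat)
qed

lemma legal_play_green_edges_subset:
  assumes "legal_play p"
  shows "green_edges (range p) \<subseteq> all_edges"
proof
  fix e assume "e \<in> green_edges (range p)"
  then obtain n where "(e, Green) = p n" unfolding green_edges_def by blast
  then have "e = fst (p n)" by (metis fst_conv)
  then show "e \<in> all_edges" using assms by (simp add: legal_play_def white_edges_def)
qed

section \<open>Connectedness in terms of edges to smaller vertices\<close>

definition downward_edges :: "nat \<Rightarrow> edge set" where
  "downward_edges n = {{k, n} | k. k < n}"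

lemma finite_downward_edges: "finite (downward_edges n)"
  unfolding downward_edges_def by simp

lemma downward_edges_ne: "n > 0 \<Longrightarrow> downward_edges n \<noteq> {}"
  unfolding downward_edges_def by auto

lemma downward_edges_subset: "downward_edges n \<subseteq> all_edges"
  unfolding downward_edges_def all_edges_def by fastforce

lemma Max_downward_edge: "e \<in> downward_edges n \<Longrightarrow> Max e = n"
  unfolding downward_edges_def by auto

lemma edge_is_downward:
  assumes "e \<in> all_edges"
  obtains n where "n > 0" "e \<in> downward_edges n"
proof -
  from assms obtain a b where "e = {a, b}" "a \<noteq> b" by (auto simp: all_edges_def)
  then have "e = {min a b, max a b}" "min a b < max a b" by (auto simp: min_def max_def)
  then show thesis using that[of "max a b"] unfolding downward_edges_def by auto
qed

text \<open>Walking down along such edges leads from every vertex to \<open>0\<close>.\<close>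

lemma connected_if_downward_edges:
  assumes "G \<in> graphs" and down: "\<And>n. n > 0 \<Longrightarrow> G \<inter> downward_edges n \<noteq> {}"
  shows "G \<in> connectedness"
proof -
  have "(n, 0) \<in> (adjacency G)\<^sup>*" for n
  proof (induction n rule: less_induct)
    case (less n)
    show ?case
    proof (cases "n = 0")
      case False
      then obtain k where "k < n" "{k, n} \<in> G"
        using down[of n] by (auto simp: downward_edges_def)
      then have "(n, k) \<in> adjacency G" by (simp add: adjacency_def insert_commute)
      with less[OF \<open>k < n\<close>] show ?thesis by (rule converse_rtrancl_into_rtrancl[rotated])
    qed simp
  qed
  moreover have "sym (adjacency G)"
    by (auto simp: sym_def adjacency_def insert_commute)
  ultimately have "(u, v) \<in> (adjacency G)\<^sup>*" for u v
    by (meson rtrancl_trans sym_rtrancl symD)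
  with assms(1) show ?thesis by (simp add: connectedness_def)
qed

text \<open>Call a smaller neighbour of a vertex its parent. If each vertex has at most one parent, and the
  root \<open>r\<close> has none, the vertices whose ancestor line reaches \<open>r\<close> are closed under adjacency:
  an edge to a larger vertex leads to a child, and an edge to a smaller one leads to the parent, which
  lies on the way to \<open>r\<close>. The vertex \<open>0\<close> is another root and hence not among them.\<close>

lemma disconnected_if_second_root:
  assumes unique: "\<And>n k l. \<lbrakk>k < n; l < n; {k, n} \<in> G; {l, n} \<in> G\<rbrakk> \<Longrightarrow> k = l"
    and loopless: "G \<subseteq> all_edges"
    and root: "r > 0" "G \<inter> downward_edges r = {}"
  shows "G \<notin> connectedness"
proof
  assume "G \<in> connectedness"
  define parent where "parent = {(v, k). k < v \<and> {k, v} \<in> G}"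
  have invariant: "(w, r) \<in> parent\<^sup>*" if v: "(v, r) \<in> parent\<^sup>*" and vw: "(v, w) \<in> adjacency G" for v w
  proof -
    have "v \<noteq> w" using vw loopless by (auto simp: adjacency_def all_edges_def doubleton_eq_iff)
    then consider "v < w" | "w < v" by linarith
    then show ?thesis
    proof cases
      case 1
      then have "(w, v) \<in> parent" using vw by (simp add: parent_def adjacency_def)
      then show ?thesis using v by (rule converse_rtrancl_into_rtrancl)
    next
      case 2
      then have "(v, w) \<in> parent" using vw by (simp add: parent_def adjacency_def insert_commute)
      moreover have "v \<noteq> r"
        using calculation root(2) by (auto simp: parent_def downward_edges_def)
      then obtain k where "(v, k) \<in> parent" "(k, r) \<in> parent\<^sup>*"
        using v by (meson converse_rtranclE)
      ultimately show ?thesis using unique by (auto simp: parent_def)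
    qed
  qed
  have "(r, 0) \<in> (adjacency G)\<^sup>*" using \<open>G \<in> connectedness\<close> by (simp add: connectedness_def)
  then have "(0, r) \<in> parent\<^sup>*" by induction (auto intro: invariant)
  then show False using root(1) by (cases rule: converse_rtranclE) (auto simp: parent_def)
qed

section \<open>Hider's strategy\<close>

text \<open>The vertex to which \<open>e\<close> is a downward edge is \<open>Max e\<close>. The set \<open>T\<close> holds the earlier turns only, so
  \<open>e\<close> itself has to be added to the picked edges.\<close>

definition last_downward_reply :: "turn set \<Rightarrow> edge \<Rightarrow> colour" where
  "last_downward_reply T e =
     (if downward_edges (Max e) \<subseteq> insert e (fst ` T) then Green else Red)"

context
  fixes p :: "nat \<Rightarrow> turn"
  assumes legal: "legal_play p"
    and reply: "\<And>i. snd (p i) = last_downward_reply (p ` {..<i}) (fst (p i))"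
begin

lemma green_downward_edge_is_last:
  assumes "fst (p i) \<in> downward_edges n"
  shows "snd (p i) = Green \<longleftrightarrow> downward_edges n \<subseteq> fst ` p ` {..i}"
proof -
  have "fst ` p ` {..i} = insert (fst (p i)) (fst ` p ` {..<i})"
    by (simp add: lessThan_Suc_atMost[symmetric] lessThan_Suc)
  with assms show ?thesis
    by (simp add: reply last_downward_reply_def Max_downward_edge)
qed

text \<open>Each of two green edges downwards from the same vertex would be picked no later than the other.\<close>

lemma green_downward_edge_unique:
  assumes "e \<in> downward_edges n" "d \<in> downward_edges n"
    and "e \<in> green_edges (range p)" "d \<in> green_edges (range p)"
  shows "e = d"
proof -
  obtain i j where i: "p i = (e, Green)" and j: "p j = (d, Green)"
    using assms(3,4) unfolding green_edges_def by (metis mem_Collect_eq rangeE)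
  have "d \<in> fst ` p ` {..i}" "e \<in> fst ` p ` {..j}"
    using green_downward_edge_is_last[of i n] green_downward_edge_is_last[of j n] i j assms(1,2)
    by auto
  then obtain i' j' where "i' \<le> i" "fst (p i') = d" "j' \<le> j" "fst (p j') = e" by auto
  moreover from this have "i' = j" "j' = i"
    using legal_play_picks_distinct[OF legal] i j by (metis fst_conv)+
  ultimately have "j \<le> i" "i \<le> j" by simp_all
  with i j show ?thesis by simp
qed

text \<open>The last pick among finitely many edges exists and is answered green.\<close>

lemma green_downward_edge_exists:
  assumes "n > 0" and picked: "downward_edges n \<subseteq> fst ` range p"
  shows "green_edges (range p) \<inter> downward_edges n \<noteq> {}"
proof -
  define I where "I = {i. fst (p i) \<in> downward_edges n}"
  have "inj (fst \<circ> p)"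
    using legal_play_picks_distinct[OF legal] by (auto intro: injI)
  then have "finite ((fst \<circ> p) -` downward_edges n)"
    by (rule finite_vimageI[OF finite_downward_edges])
  then have fin: "finite I" by (simp add: I_def vimage_def)
  moreover have "I \<noteq> {}"
    using downward_edges_ne[OF assms(1)] picked unfolding I_def by fastforce
  ultimately have last: "Max I \<in> I" by simp
  have "downward_edges n \<subseteq> fst ` p ` {..Max I}"
  proof
    fix e assume "e \<in> downward_edges n"
    moreover from this picked obtain i where "e = fst (p i)" by auto
    ultimately show "e \<in> fst ` p ` {..Max I}" using fin by (auto simp: I_def)
  qed
  with last have "snd (p (Max I)) = Green"
    using green_downward_edge_is_last by (simp add: I_def)
  then have "fst (p (Max I)) \<in> green_edges (range p)"
    unfolding green_edges_def by (metis mem_Collect_eq prod.collapse rangeI)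
  with last show ?thesis by (auto simp: I_def)
qed

lemma green_or_white_connected:
  "green_edges (range p) \<union> white_edges (range p) \<in> connectedness"
proof (rule connected_if_downward_edges)
  show "green_edges (range p) \<union> white_edges (range p) \<in> graphs"
    using legal_play_green_edges_subset[OF legal] by (auto simp: graphs_def white_edges_def)
  show "(green_edges (range p) \<union> white_edges (range p)) \<inter> downward_edges n \<noteq> {}" if "n > 0" for n
  proof (cases "downward_edges n \<subseteq> fst ` range p")
    case True
    with green_downward_edge_exists[OF that] show ?thesis by auto
  next
    case False
    with downward_edges_subset[of n] show ?thesis by (auto simp: white_edges_def)
  qed
qed

lemma green_disconnected:
  assumes "white_edges (range p) \<noteq> {}"
  shows "green_edges (range p) \<notin> connectedness"
proof -
  obtain e where e: "e \<in> all_edges" "e \<notin> fst ` range p"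
    using assms by (auto simp: white_edges_def)
  obtain n where n: "n > 0" "e \<in> downward_edges n" using edge_is_downward[OF e(1)] .
  have no_parent: "green_edges (range p) \<inter> downward_edges n = {}"
  proof (rule ccontr)
    assume "\<not> ?thesis"
    then obtain d where "(d, Green) \<in> range p" "d \<in> downward_edges n"
      unfolding green_edges_def by blast
    moreover from this obtain i where "p i = (d, Green)" by (metis rangeE)
    ultimately have "downward_edges n \<subseteq> fst ` range p"
      using green_downward_edge_is_last[of i n] by auto
    with e n show False by auto
  qed
  have "k = l" if "k < m" "l < m" "{k, m} \<in> green_edges (range p)" "{l, m} \<in> green_edges (range p)"
    for m k l
    using green_downward_edge_unique[of "{k, m}" m "{l, m}"] that
    by (auto simp: downward_edges_def doubleton_eq_iff)
  then show ?thesis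
    using legal_play_green_edges_subset[OF legal] n(1) no_parent
    by (rule disconnected_if_second_root)
qed

lemma seeker_loses: "\<not> seeker_wins connectedness p"
proof
  assume wins: "seeker_wins connectedness p"
  let ?G = "green_edges (range p)" and ?W = "white_edges (range p)"
  have "?G \<in> possible_graphs p" "?G \<union> ?W \<in> possible_graphs p"
    using legal_play_green_edges_subset[OF legal]
    by (auto simp: possible_graphs_def graphs_def white_edges_def)
  with wins green_disconnected green_or_white_connected show False
    unfolding seeker_wins_def by blast
qed

end

theorem theorem3p3: "infinity_elusive connectedness"
  unfolding infinity_elusive_def
proof
  assume "\<exists>\<sigma>. winning_strategy connectedness \<sigma>"
  then obtain \<sigma> where \<sigma>: "winning_strategy connectedness \<sigma>" ..
  then have "seeker_strategy \<sigma>" by (simp add: winning_strategy_def)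
  then obtain p where p: "legal_play p" "follows \<sigma> p"
    "\<forall>i. snd (p i) = last_downward_reply (p ` {..<i}) (fst (p i))"
    by (rule play_against_reply_exists[where reply = last_downward_reply])
  then have "seeker_wins connectedness p" using \<sigma> by (simp add: winning_strategy_def)
  with seeker_loses[OF p(1)] p(3) show False by blast
qed

end
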